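(* Let $n \geq 2$ and let $K$ be a nonempty bounded open convex set in $\mathbf{R}^n$, equipped with its Hilbert distance $d_K$. Suppose that for every triangle in $(K,d_K)$ the three medians (taken with respect to $d_K$) all pass through one point. Then $K$ is an open ellipsoid.
   Context: Hilbert distance: let $K \subset \mathbf{R}^n$ be a nonempty bounded open convex set and $|\cdot|$ the Euclidean norm. For $x \in K$ put $d_K(x,x)=0$. For distinct $x,y \in K$, the straight line through $x,y$ meets the boundary $\partial \overline{K}$ in two points $a,b$, named so that the order of the four points on the line is $a,x,y,b$; put $$d_K(x,y)=\frac12 \ln\left(\frac{|y-a|}{|x-a|}\cdot\frac{|x-b|}{|y-b|}\right).$$ The metric space $(K,d_K)$ is called a Hilbert geometry; straight line segments are geodesics in it. Triangle: a triangle in $(K,d_K)$ is given by three non-collinear points $A,B,C \in K$, its edges being the straight line segments $BC$, $AC$, $AB$. Midpoints and medians: the midpoint of an edge $XY$ with respect to $d_K$ is the (unique) point $Z$ of the straight segment $XY$ with $d_K(X,Z)=d_K(Z,Y)$. A median of the triangle is the straight segment joining a vertex to the $d_K$-midpoint of the opposite edge. Open ellipsoid: a set which, up to a Euclidean isometry of $\mathbf{R}^n$, has the form $\{(x_1,\dots,x_n)\in \mathbf{R}^n \mid \sum_{i=1}^n x_i^2/a_i^2<1\}$ for some nonzero real numbers $a_1,\dots,a_n$ (equivalently, the image of the open unit ball under an invertible affine map); when $n=2$ this is an open ellipse. *)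

theory Defs
  imports "HOL-Analysis.Analysis"
begin

(* For distinct x, y in K: the endpoint of the chord of K through x and y that lies beyond y.
   In the order a, x, y, b on the line, b = chord_end K x y and a = chord_end K y x. For K open,
   bounded and convex the described point exists and is unique. *)
definition chord_end :: "'a::euclidean_space set \<Rightarrow> 'a \<Rightarrow> 'a \<Rightarrow> 'a" where
  "chord_end K x y = (THE b. b \<in> frontier (closure K) \<and> y \<in> open_segment x b)"

definition hilbert_dist :: "'a::euclidean_space set \<Rightarrow> 'a \<Rightarrow> 'a \<Rightarrow> real" where
  "hilbert_dist K x y =
     (if x = y then 0
      else let a = chord_end K y x; b = chord_end K x y
           in 1 / 2 * ln (norm (y - a) / norm (x - a) * (norm (x - b) / norm (y - b))))"

definition hilbert_midpoint :: "'a::euclidean_space set \<Rightarrow> 'a \<Rightarrow> 'a \<Rightarrow> 'a" where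
  "hilbert_midpoint K X Y =
     (THE Z. Z \<in> closed_segment X Y \<and> hilbert_dist K X Z = hilbert_dist K Z Y)"

definition hilbert_triangle :: "'a::euclidean_space set \<Rightarrow> 'a \<Rightarrow> 'a \<Rightarrow> 'a \<Rightarrow> bool" where
  "hilbert_triangle K A B C \<longleftrightarrow> A \<in> K \<and> B \<in> K \<and> C \<in> K \<and> \<not> collinear {A, B, C}"

(* The median from the vertex A to the edge BC, as a set of points. *)
definition hilbert_median :: "'a::euclidean_space set \<Rightarrow> 'a \<Rightarrow> 'a \<Rightarrow> 'a \<Rightarrow> 'a set" where
  "hilbert_median K A B C = closed_segment A (hilbert_midpoint K B C)"

(* A distance-preserving self-map f of a Euclidean space is automatically bijective. *)
definition open_ellipsoid :: "(real ^ 'n) set \<Rightarrow> bool" where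
  "open_ellipsoid K \<longleftrightarrow>
     (\<exists>(f :: real ^ 'n \<Rightarrow> real ^ 'n) (a :: real ^ 'n).
        (\<forall>x y. dist (f x) (f y) = dist x y) \<and> (\<forall>i. a $ i \<noteq> 0) \<and>
        K = f ` {x. (\<Sum>i\<in>UNIV. (x $ i)\<^sup>2 / (a $ i)\<^sup>2) < 1})"

end

(*
  On the chord through X and Y with ends a, b, the Hilbert midpoint Z satisfies
  XZ : ZY = sqrt (Xa * Xb) : sqrt (Ya * Yb).  By Ceva, concurrency of the medians says that the
  ratio (Xa * Xb) / (Ya * Yb) is a multiplicative cocycle on non-collinear triples.  Hence, with a
  base point p in K and H(X) = (Xa * Xb) / (pa * pb) on the line pX, the function H is, on every
  line, a constant multiple of Xa * Xb, that is, a quadratic polynomial.  If g is the Minkowski gauge of K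
  about p, then H(p + x) = (1 + g(-x)) (1 - g(x)) = 1 + L(x) - Q(x) with L and Q homogeneous of
  degree 1 and 2.  Being quadratic on every line forces L to be linear and Q to be a quadratic
  form, positive definite because K is bounded.  So K = {H > 0} is an ellipsoid.
*)

theory Submission
  imports Defs
begin

section \<open>Hilbert midpoints\<close>

locale open_convex_body =
  fixes K :: "'a::euclidean_space set"
  assumes bounded_K: "bounded K" and open_K: "open K" and convex_K: "convex K"
begin

section \<open>Exit times of rays and the ends of chords\<close>

text \<open>Time is measured in multiples of \<open>u\<close>, whose norm is arbitrary, so chord
  ends become plain parameters on a line. The value is specified only for \<open>x\<close> in
  \<open>K\<close> and nonzero \<open>u\<close>; otherwise no such \<open>t\<close> exists.\<close>

definition exit_time :: "'a \<Rightarrow> 'a \<Rightarrow> real" where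
  "exit_time x u = (SOME t. 0 < t \<and> (\<forall>s\<ge>0. x + s *\<^sub>R u \<in> K \<longleftrightarrow> s < t))"

lemma exit_time_eq:
  assumes "0 < t" "\<And>s. 0 \<le> s \<Longrightarrow> x + s *\<^sub>R u \<in> K \<longleftrightarrow> s < t"
  shows "exit_time x u = t"
  unfolding exit_time_def
proof (rule some_equality)
  fix t' assume t': "0 < t' \<and> (\<forall>s\<ge>0. x + s *\<^sub>R u \<in> K \<longleftrightarrow> s < t')"
  then have "0 \<le> t'" "t < t' \<longleftrightarrow> t < t" "t' < t \<longleftrightarrow> t' < t'"
    using assms(2)[of t] assms(2)[of t'] assms(1) by auto
  then show "t' = t" by auto
qed (use assms in auto)

text \<open>Boundedness makes the ray reach the frontier, openness keeps the frontier out of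
  \<open>K\<close>, and convexity forbids re-entry: the frontier point would be a convex combination
  of \<open>x\<close> and a later point of \<open>K\<close>.\<close>

lemma exit_time_frontier:
  assumes "x \<in> K" "u \<noteq> 0"
  shows "0 < exit_time x u \<and> x + exit_time x u *\<^sub>R u \<in> frontier K
     \<and> (\<forall>s\<ge>0. x + s *\<^sub>R u \<in> K \<longleftrightarrow> s < exit_time x u)"
proof -
  obtain d where d: "0 < d" "x + d *\<^sub>R u \<in> frontier K"
    "\<And>e. 0 \<le> e \<Longrightarrow> e < d \<Longrightarrow> x + e *\<^sub>R u \<in> interior K"
    using ray_to_frontier[OF bounded_K, of x u] assms open_K by (auto simp: interior_open)
  have nin: "x + d *\<^sub>R u \<notin> K"
    using d(2) open_K by (simp add: frontier_def interior_open)
  have *: "x + s *\<^sub>R u \<in> K \<longleftrightarrow> s < d" if s: "0 \<le> s" for s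
  proof
    assume sK: "x + s *\<^sub>R u \<in> K"
    show "s < d"
    proof (rule ccontr)
      assume "\<not> s < d"
      then have "0 \<le> d / s" "d / s \<le> 1" "s \<noteq> 0" using d(1) by auto
      moreover have "(1 - d / s) *\<^sub>R x + (d / s) *\<^sub>R (x + s *\<^sub>R u) = x + d *\<^sub>R u"
        using \<open>s \<noteq> 0\<close> by (simp add: algebra_simps)
      ultimately show False
        using convexD_alt[OF convex_K assms(1) sK, of "d / s"] nin by auto
    qed
  next
    assume "s < d" then show "x + s *\<^sub>R u \<in> K" using d(3) s open_K by (auto simp: interior_open)
  qed
  then have "exit_time x u = d" using d(1) by (intro exit_time_eq) auto
  with d * show ?thesis by auto
qed

lemma exit_time_pos: "x \<in> K \<Longrightarrow> u \<noteq> 0 \<Longrightarrow> 0 < exit_time x u"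
  using exit_time_frontier by blast

lemma mem_line_iff:
  assumes "x \<in> K" "u \<noteq> 0"
  shows "x + s *\<^sub>R u \<in> K \<longleftrightarrow> - exit_time x (- u) < s \<and> s < exit_time x u"
proof (cases "0 \<le> s")
  case True
  then show ?thesis
    using exit_time_frontier[OF assms] exit_time_pos[of x "-u"] assms by force
next
  case False
  have "x + s *\<^sub>R u = x + (- s) *\<^sub>R (- u)" by simp
  then have "x + s *\<^sub>R u \<in> K \<longleftrightarrow> - s < exit_time x (- u)"
    using exit_time_frontier[of x "- u"] assms False by (metis linear neg_0_le_iff_le neg_equal_0_iff_equal)
  then show ?thesis using exit_time_pos[OF assms] False by auto
qed

lemma exit_time_scale:
  assumes "x \<in> K" "u \<noteq> 0" "0 < c"
  shows "exit_time x (c *\<^sub>R u) = exit_time x u / c"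
proof (rule exit_time_eq)
  fix s :: real assume "0 \<le> s"
  then show "x + s *\<^sub>R c *\<^sub>R u \<in> K \<longleftrightarrow> s < exit_time x u / c"
    using exit_time_frontier[OF assms(1,2)] assms(3) by (auto simp: pos_less_divide_eq)
qed (use exit_time_pos assms in auto)

lemma exit_time_shift:
  assumes "x \<in> K" "u \<noteq> 0" "x + s *\<^sub>R u \<in> K"
  shows "exit_time (x + s *\<^sub>R u) u = exit_time x u - s"
proof (rule exit_time_eq)
  note s = assms(3)[unfolded mem_line_iff[OF assms(1,2)]]
  then show "0 < exit_time x u - s" by simp
  fix r :: real assume "0 \<le> r"
  have e: "x + s *\<^sub>R u + r *\<^sub>R u = x + (s + r) *\<^sub>R u" by (simp add: algebra_simps)
  show "x + s *\<^sub>R u + r *\<^sub>R u \<in> K \<longleftrightarrow> r < exit_time x u - s"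
    unfolding e mem_line_iff[OF assms(1,2)] using s \<open>0 \<le> r\<close> by auto
qed

lemma exit_time_shift_minus:
  assumes "x \<in> K" "u \<noteq> 0" "x + s *\<^sub>R u \<in> K"
  shows "exit_time (x + s *\<^sub>R u) (- u) = exit_time x (- u) + s"
  using exit_time_shift[of x "- u" "- s"] assms by simp

text \<open>A convex set and its closure have the same interior. This connects
  \<open>chord_end\<close>, which is stated with the closure, to exit times, which concern
  \<open>K\<close> itself.\<close>

lemma frontier_closure_K: "frontier (closure K) = frontier K"
  by (simp add: frontier_def convex_interior_closure convex_K)

text \<open>For uniqueness, a candidate \<open>b\<close> sits at parameter \<open>1 / w\<close> on
  the ray. A parameter below the exit time would put \<open>b\<close> inside \<open>K\<close>; one
  above it would put the exit point strictly between the interior point \<open>x\<close> and the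
  closure point \<open>b\<close>, hence inside \<open>K\<close>.\<close>

lemma chord_end_eq:
  assumes "x \<in> K" "y \<in> K" "x \<noteq> y"
  shows "chord_end K x y = x + exit_time x (y - x) *\<^sub>R (y - x)"
  unfolding chord_end_def
proof (rule the_equality)
  let ?u = "y - x" and ?t = "exit_time x (y - x)"
  have u: "?u \<noteq> 0" using assms by simp
  note E = exit_time_frontier[OF assms(1) u]
  have t1: "1 < ?t" using E[THEN conjunct2, THEN conjunct2, rule_format, of 1] assms by simp
  have "y = (1 - 1 / ?t) *\<^sub>R x + (1 / ?t) *\<^sub>R (x + ?t *\<^sub>R ?u)"
    using t1 by (simp add: algebra_simps)
  moreover have "x \<noteq> x + ?t *\<^sub>R ?u" using u t1 by simp
  ultimately have "y \<in> open_segment x (x + ?t *\<^sub>R ?u)"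
    unfolding in_segment using t1 by (intro conjI exI[of _ "1 / ?t"]) auto
  then show "x + ?t *\<^sub>R ?u \<in> frontier (closure K) \<and> y \<in> open_segment x (x + ?t *\<^sub>R ?u)"
    using E by (simp add: frontier_closure_K)
  fix b assume b: "b \<in> frontier (closure K) \<and> y \<in> open_segment x b"
  then have bf: "b \<in> frontier K" by (simp add: frontier_closure_K)
  then have bK: "b \<notin> K" "b \<in> closure K"
    using open_K by (auto simp: frontier_def interior_open)
  obtain w where w: "0 < w" "w < 1" "y = (1 - w) *\<^sub>R x + w *\<^sub>R b"
    using b by (auto simp: in_segment)
  have "?u = w *\<^sub>R (b - x)" using w(3) by (simp add: algebra_simps)
  then have "x + (1 / w) *\<^sub>R ?u = b" using w by simp
  then have "\<not> 1 / w < ?t" using E bK w by (metis divide_nonneg_pos zero_le_one)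
  moreover have "\<not> ?t < 1 / w"
  proof
    assume "?t < 1 / w"
    then have tw: "?t * w < 1" using w(1) by (simp add: pos_less_divide_eq)
    have "x + ?t *\<^sub>R ?u = (1 - ?t * w) *\<^sub>R x + (?t * w) *\<^sub>R b"
    proof -
      have "(1 - t * w) *\<^sub>R x + (t * w) *\<^sub>R b = x + t *\<^sub>R (w *\<^sub>R (b - x))" for t
        by (simp add: algebra_simps)
      then show ?thesis by (simp only: \<open>?u = w *\<^sub>R (b - x)\<close>)
    qed
    moreover have "x \<noteq> b" using bK assms by auto
    ultimately have "x + ?t *\<^sub>R ?u \<in> open_segment x b"
      unfolding in_segment using tw w(1,2) t1 by (intro conjI exI[of _ "?t * w"]) (assumption | simp)+
    then have "x + ?t *\<^sub>R ?u \<in> K"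
      using in_interior_closure_convex_segment[OF convex_K, of x b] assms open_K bK
      by (auto simp: interior_open)
    then show False using E t1 by force
  qed
  ultimately have "?t = 1 / w" by simp
  then show "b = x + ?t *\<^sub>R ?u" using \<open>x + (1 / w) *\<^sub>R ?u = b\<close> by simp
qed

section \<open>Hilbert distance and midpoint in coordinates along a line\<close>

text \<open>In the parameter along \<open>u\<close> the chord ends are \<open>-a\<close> and
  \<open>b\<close>, and the factor \<open>norm u\<close> cancels in the cross-ratio.\<close>

lemma hilbert_dist_line:
  assumes x: "x \<in> K" and u: "u \<noteq> 0" and sK: "x + s *\<^sub>R u \<in> K" and tK: "x + t *\<^sub>R u \<in> K" and st: "s < t"
  defines "a \<equiv> exit_time x (- u)" and "b \<equiv> exit_time x u"
  shows "hilbert_dist K (x + s *\<^sub>R u) (x + t *\<^sub>R u)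
    = 1 / 2 * ln ((t + a) / (s + a) * ((b - s) / (b - t)))"
proof -
  have bs: "- a < s" "s < b" "- a < t" "t < b"
    using sK tK mem_line_iff[OF x u] by (auto simp: a_def b_def)
  let ?X = "x + s *\<^sub>R u" and ?Y = "x + t *\<^sub>R u"
  have ne: "?X \<noteq> ?Y" using u st by simp
  have d1: "?Y - ?X = (t - s) *\<^sub>R u" and d2: "?X - ?Y = (t - s) *\<^sub>R (- u)"
    by (simp_all add: algebra_simps)
  \<comment> \<open>\<open>chord_end_eq\<close> measures time in multiples of
    \<open>?Y - ?X\<close>, hence the rescaling by \<open>t - s\<close>.\<close>
  have "chord_end K ?X ?Y = ?X + ((b - s) / (t - s)) *\<^sub>R (t - s) *\<^sub>R u"
    unfolding chord_end_eq[OF sK tK ne] d1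
    using exit_time_scale[OF sK u, of "t - s"] exit_time_shift[OF x u sK] st by (simp add: b_def)
  also have "\<dots> = ?X + (b - s) *\<^sub>R u" using st by simp
  finally have e1: "chord_end K ?X ?Y = x + b *\<^sub>R u"
    by (simp add: algebra_simps)
  have "chord_end K ?Y ?X = ?Y + ((a + t) / (t - s)) *\<^sub>R (t - s) *\<^sub>R (- u)"
    unfolding chord_end_eq[OF tK sK ne[symmetric]] d2
    using exit_time_scale[OF tK, of "- u" "t - s"] exit_time_shift_minus[OF x u tK] st u
    by (simp add: a_def)
  also have "\<dots> = ?Y - (a + t) *\<^sub>R u" using st by simp
  finally have e2: "chord_end K ?Y ?X = x - a *\<^sub>R u"
    by (simp add: algebra_simps)
  have n: "norm (?Y - (x - a *\<^sub>R u)) = (t + a) * norm u" "norm (?X - (x - a *\<^sub>R u)) = (s + a) * norm u"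
    "norm (?X - (x + b *\<^sub>R u)) = (b - s) * norm u" "norm (?Y - (x + b *\<^sub>R u)) = (b - t) * norm u"
  proof -
    have "?Y - (x - a *\<^sub>R u) = (t + a) *\<^sub>R u" "?X - (x - a *\<^sub>R u) = (s + a) *\<^sub>R u"
      "?X - (x + b *\<^sub>R u) = - ((b - s) *\<^sub>R u)" "?Y - (x + b *\<^sub>R u) = - ((b - t) *\<^sub>R u)"
      by (simp_all add: algebra_simps)
    then show "norm (?Y - (x - a *\<^sub>R u)) = (t + a) * norm u" "norm (?X - (x - a *\<^sub>R u)) = (s + a) * norm u"
    "norm (?X - (x + b *\<^sub>R u)) = (b - s) * norm u" "norm (?Y - (x + b *\<^sub>R u)) = (b - t) * norm u"
      using bs by simp_all
  qed
  have "norm u \<noteq> 0" using u by simp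
  then have "hilbert_dist K ?X ?Y = 1 / 2 * ln (((t + a) * norm u) / ((s + a) * norm u) * (((b - s) * norm u) / ((b - t) * norm u)))"
    unfolding hilbert_dist_def Let_def e1 e2 n using ne by (simp only: if_False)
  then show ?thesis using \<open>norm u \<noteq> 0\<close> by simp
qed

text \<open>If \<open>a\<close>, \<open>b\<close> are the ends of the chord through \<open>x\<close> in direction \<open>u\<close>, this is
  \<open>|x - a| |x - b| / |u|\<^sup>2\<close>.\<close>

definition power_along :: "'a \<Rightarrow> 'a \<Rightarrow> real" where
  "power_along x u = exit_time x u * exit_time x (- u)"

lemma power_along_minus: "power_along x (- u) = power_along x u"
  by (simp add: power_along_def)

lemma power_along_pos: "x \<in> K \<Longrightarrow> u \<noteq> 0 \<Longrightarrow> 0 < power_along x u"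
  by (simp add: power_along_def exit_time_pos)

lemma power_along_scale:
  assumes "x \<in> K" "u \<noteq> 0" "c \<noteq> 0"
  shows "power_along x (c *\<^sub>R u) = power_along x u / c\<^sup>2"
proof -
  have pos: "power_along x (c *\<^sub>R u) = power_along x u / c\<^sup>2" if "0 < c" for c
    using exit_time_scale[of x u c] exit_time_scale[of x "- u" c] assms that
    by (simp add: power_along_def power2_eq_square)
  show ?thesis
    using pos[of c] pos[of "- c"] power_along_minus[of x "c *\<^sub>R u"] assms(3) by (cases "0 < c") auto
qed

text \<open>With \<open>X\<close> at 0, \<open>Y\<close> at 1 and the chord ends at
  \<open>-a\<close> and \<open>b\<close>, the last equation is the square root of the condition that
  the point at \<open>m\<close> is equidistant from \<open>X\<close> and \<open>Y\<close>.\<close>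

lemma midpoint_equation:
  fixes a b :: real
  assumes "0 < a" "1 < b"
  defines "m \<equiv> sqrt (a * b) / (sqrt (a * b) + sqrt ((1 + a) * (b - 1)))"
  shows "0 < m" "m < 1" "(m + a) * sqrt (b * (b - 1)) = (b - m) * sqrt (a * (1 + a))"
proof -
  \<comment> \<open>In these four roots everything is rational;
    \<open>A1\<^sup>2 = A\<^sup>2 + 1\<close> and \<open>B1\<^sup>2 = B\<^sup>2 - 1\<close> then
    expose the common factor \<open>A1 * B + A * B1\<close> of both sides.\<close>
  define A A1 B B1 where d: "A = sqrt a" "A1 = sqrt (1 + a)" "B = sqrt b" "B1 = sqrt (b - 1)"
  have p: "A > 0" "A1 > 0" "B > 0" "B1 > 0" using assms by (auto simp: d)
  have sq: "A\<^sup>2 = a" "A1\<^sup>2 = A\<^sup>2 + 1" "B\<^sup>2 = b" "B1\<^sup>2 = B\<^sup>2 - 1" using assms by (auto simp: d)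
  have r: "sqrt (a * b) = A * B" "sqrt ((1 + a) * (b - 1)) = A1 * B1" "sqrt (b * (b - 1)) = B * B1"
    "sqrt (a * (1 + a)) = A * A1" by (simp_all add: d real_sqrt_mult)
  have m: "m = A * B / (A * B + A1 * B1)" by (simp add: m_def r)
  have ps: "A * B + A1 * B1 > 0" using p by (simp add: add_pos_pos)
  show "0 < m" "m < 1" using p ps by (auto simp: m)
  have e1: "(m + A\<^sup>2) * (A * B + A1 * B1) = A * B + A\<^sup>2 * (A * B + A1 * B1)"
    and e2: "(B\<^sup>2 - m) * (A * B + A1 * B1) = B\<^sup>2 * (A * B + A1 * B1) - A * B"
    using ps by (auto simp: m field_simps)
  have "A * B + A\<^sup>2 * (A * B + A1 * B1) = A * A1 * (A1 * B + A * B1)"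
    using sq(2) by algebra
  moreover have "B\<^sup>2 * (A * B + A1 * B1) - A * B = B * B1 * (A1 * B + A * B1)"
    using sq(4) by algebra
  ultimately have "((m + A\<^sup>2) * (B * B1)) * (A * B + A1 * B1) = ((B\<^sup>2 - m) * (A * A1)) * (A * B + A1 * B1)"
    using e1 e2 by algebra
  then show "(m + a) * sqrt (b * (b - 1)) = (b - m) * sqrt (a * (1 + a))"
    using ps sq r by simp
qed

text \<open>Equating the two distances and cross-multiplying gives an equality of squares of
  nonnegative quantities. Its root is linear in the parameter \<open>s\<close>, so \<open>m\<close>
  is the only solution, which settles both existence and uniqueness for \<open>THE\<close>.\<close>

lemma hilbert_midpoint_eq:
  assumes X: "X \<in> K" and Y: "Y \<in> K" and ne: "X \<noteq> Y"
  defines "p \<equiv> sqrt (power_along X (Y - X))" and "q \<equiv> sqrt (power_along Y (Y - X))"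
  shows "hilbert_midpoint K X Y = (q / (p + q)) *\<^sub>R X + (p / (p + q)) *\<^sub>R Y"
proof -
  define u where "u = Y - X"
  define a where "a = exit_time X (- u)"
  define b where "b = exit_time X u"
  have u: "u \<noteq> 0" using ne by (simp add: u_def)
  have Yu: "Y = X + 1 *\<^sub>R u" by (simp add: u_def)
  have a: "0 < a" using exit_time_pos[OF X, of "- u"] u by (simp add: a_def)
  have b: "1 < b" using Y mem_line_iff[OF X u, of 1] by (simp add: u_def b_def)
  have p: "p = sqrt (a * b)" by (simp add: p_def power_along_def flip: u_def a_def b_def)
  have q: "q = sqrt ((1 + a) * (b - 1))"
    using exit_time_shift[OF X u, of 1] exit_time_shift_minus[OF X u, of 1] Y
    by (simp add: q_def power_along_def u_def a_def b_def)
  define m where "m = p / (p + q)"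
  note M = midpoint_equation[OF a b, folded p q, folded m_def]
  have pq: "p > 0" "q > 0" using a b by (auto simp: p q)
  have inK: "X + s *\<^sub>R u \<in> K" if "0 \<le> s" "s \<le> 1" for s
    using mem_line_iff[OF X u, of s] that a b by (simp add: a_def b_def)
  have mid: "hilbert_dist K X (X + s *\<^sub>R u) = hilbert_dist K (X + s *\<^sub>R u) Y \<longleftrightarrow> s = m"
    if s: "0 \<le> s" "s \<le> 1" for s
  proof (cases "s = 0 \<or> s = 1")
    case True
    \<comment> \<open>At an endpoint one distance is 0 and the other is that of \<open>X\<close> and
      \<open>Y\<close>, so neither end is a midpoint.\<close>
    have "0 < hilbert_dist K X Y"
    proof -
      have "1 + a > a" "b > b - 1" by auto
      then have "1 < (1 + a) / a" "1 < b / (b - 1)" using a b by auto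
      then have "1 < (1 + a) / a * (b / (b - 1))" by (rule less_1_mult)
      then have "0 < ln ((1 + a) / a * (b / (b - 1)))" by (rule ln_gt_zero)
      moreover have "hilbert_dist K X Y = 1 / 2 * ln ((1 + a) / a * (b / (b - 1)))"
        using hilbert_dist_line[OF X u, of 0 1] X Y Yu by (simp add: a_def b_def)
      ultimately show ?thesis by simp
    qed
    then show ?thesis using True M ne by (auto simp: u_def hilbert_dist_def[of K X X] hilbert_dist_def[of K Y Y])
  next
    case False
    then have s: "0 < s" "s < 1" using s by auto
    let ?l = "(s + a) / a * (b / (b - s))" and ?r = "(1 + a) / (s + a) * ((b - s) / (b - 1))"
    have "hilbert_dist K X (X + s *\<^sub>R u) = 1 / 2 * ln ?l"
      using hilbert_dist_line[OF X u, of 0 s] X inK[of s] s by (simp add: a_def b_def)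
    moreover have "hilbert_dist K (X + s *\<^sub>R u) Y = 1 / 2 * ln ?r"
      using hilbert_dist_line[OF X u inK, of s 1] Y Yu s by (simp add: a_def b_def)
    moreover have "?l > 0" "?r > 0" using a b s by auto
    ultimately have "hilbert_dist K X (X + s *\<^sub>R u) = hilbert_dist K (X + s *\<^sub>R u) Y \<longleftrightarrow> ?l = ?r"
      by (simp only: mult_cancel_left ln_inj_iff) simp
    also have "\<dots> \<longleftrightarrow> (s + a)\<^sup>2 * (b * (b - 1)) = (b - s)\<^sup>2 * (a * (1 + a))"
      using a b s by (simp add: divide_simps power2_eq_square) (auto simp: algebra_simps)
    also have "\<dots> \<longleftrightarrow> ((s + a) * sqrt (b * (b - 1)))\<^sup>2 = ((b - s) * sqrt (a * (1 + a)))\<^sup>2"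
      using a b by (simp add: power_mult_distrib)
    also have "\<dots> \<longleftrightarrow> (s + a) * sqrt (b * (b - 1)) = (b - s) * sqrt (a * (1 + a))"
      using a b s by (intro power2_eq_iff_nonneg) auto
    also have "\<dots> \<longleftrightarrow> s = m"
    proof -
      define c d where cd: "c = sqrt (b * (b - 1))" "d = sqrt (a * (1 + a))"
      have pos: "c + d \<noteq> 0" using a b by (auto simp: cd add_pos_pos less_imp_neq[symmetric])
      \<comment> \<open>Subtracting the same equation for \<open>m\<close> leaves the factor
        \<open>s - m\<close>.\<close>
      have "(s + a) * c = (b - s) * d \<longleftrightarrow> (s - m) * (c + d) = 0"
        using M(3)[folded cd] by (auto simp: algebra_simps)
      then show ?thesis using pos by (simp add: cd)
    qed
    finally show ?thesis .
  qed
  have seg: "Z \<in> closed_segment X Y \<longleftrightarrow> (\<exists>s. 0 \<le> s \<and> s \<le> 1 \<and> Z = X + s *\<^sub>R u)" for Z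
    by (auto simp: in_segment u_def algebra_simps)
  have "hilbert_midpoint K X Y = X + m *\<^sub>R u"
    unfolding hilbert_midpoint_def seg
  proof (rule the_equality)
    show "(\<exists>s\<ge>0. s \<le> 1 \<and> X + m *\<^sub>R u = X + s *\<^sub>R u) \<and>
      hilbert_dist K X (X + m *\<^sub>R u) = hilbert_dist K (X + m *\<^sub>R u) Y"
      using mid[of m] M(1,2) by (auto intro!: exI[of _ m])
  qed (use mid in auto)
  also have "\<dots> = (1 - m) *\<^sub>R X + m *\<^sub>R Y" by (simp add: u_def algebra_simps)
  also have "1 - m = q / (p + q)" using pq by (simp add: m_def field_simps)
  finally show ?thesis by (simp add: m_def)
qed

end

section \<open>Concurrent medians and the power of a point\<close>

text \<open>Independence of an ordered pair: unlike independence of the set of the two vectors, it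
  fails when \<open>x = y\<close>.\<close>

definition indep2 :: "'a::real_vector \<Rightarrow> 'a \<Rightarrow> bool" where
  "indep2 x y \<longleftrightarrow> (\<forall>r t. r *\<^sub>R x + t *\<^sub>R y = 0 \<longrightarrow> r = 0 \<and> t = 0)"

lemma indep2_nz: "indep2 x y \<Longrightarrow> x \<noteq> 0 \<and> y \<noteq> 0 \<and> x \<noteq> y"
proof -
  assume i: "indep2 x y"
  then have "x \<noteq> 0" "y \<noteq> 0"
    using i[unfolded indep2_def, rule_format, of 1 0] i[unfolded indep2_def, rule_format, of 0 1] by auto
  moreover have "x \<noteq> y" using i[unfolded indep2_def, rule_format, of 1 "-1"] by auto
  ultimately show ?thesis by simp
qed

lemma indep2_eq:
  assumes "indep2 b c" "r *\<^sub>R b + t *\<^sub>R c = r' *\<^sub>R b + t' *\<^sub>R c"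
  shows "r = r' \<and> t = t'"
proof -
  have "(r - r') *\<^sub>R b + (t - t') *\<^sub>R c = 0"
    using assms(2) by (simp add: algebra_simps)
  then show ?thesis using assms(1) unfolding indep2_def by force
qed

lemma not_indep2E:
  assumes "\<not> indep2 x y"
  obtains "x = 0" | c where "y = c *\<^sub>R x"
proof -
  obtain r t where rt: "r *\<^sub>R x + t *\<^sub>R y = 0" "r \<noteq> 0 \<or> t \<noteq> 0"
    using assms unfolding indep2_def by auto
  show thesis
  proof (cases "t = 0")
    case True then show ?thesis using rt that(1) by auto
  next
    case False
    have "t *\<^sub>R y = (- r) *\<^sub>R x" using rt(1) by (simp add: add_eq_0_iff2)
    then have "inverse t *\<^sub>R (t *\<^sub>R y) = inverse t *\<^sub>R ((- r) *\<^sub>R x)" by (rule arg_cong)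
    then have "y = (- (inverse t * r)) *\<^sub>R x" using False by simp
    then show ?thesis using that(2) by blast
  qed
qed

lemma indep2_scale: "indep2 x y \<Longrightarrow> c \<noteq> 0 \<Longrightarrow> indep2 (c *\<^sub>R x) (c *\<^sub>R y)"
  unfolding indep2_def by (metis mult_eq_0_iff scaleR_scaleR)

lemma indep2_shear:
  assumes "indep2 x y" "r \<noteq> 0" shows "indep2 x (x + r *\<^sub>R y)"
  unfolding indep2_def
proof (intro allI impI)
  fix p q assume "p *\<^sub>R x + q *\<^sub>R (x + r *\<^sub>R y) = 0"
  then have "(p + q) *\<^sub>R x + (q * r) *\<^sub>R y = 0" by (simp add: algebra_simps)
  then show "p = 0 \<and> q = 0" using assms unfolding indep2_def by force
qed

lemma indep2_swap: "indep2 x y \<Longrightarrow> indep2 y x"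
  unfolding indep2_def by (metis add.commute)

lemma indep2_not_collinear:
  assumes "indep2 b c" shows "\<not> collinear {A, A + b, A + c}"
proof
  assume "collinear {A, A + b, A + c}"
  then obtain w where w: "\<And>x y. x \<in> {A, A + b, A + c} \<Longrightarrow> y \<in> {A, A + b, A + c} \<Longrightarrow> \<exists>k. x - y = k *\<^sub>R w"
    unfolding collinear_def by blast
  from w[of "A + b" A] w[of "A + c" A] obtain k l where "b = k *\<^sub>R w" "c = l *\<^sub>R w" by auto
  then have "l *\<^sub>R b + (- k) *\<^sub>R c = 0" by simp
  then have "k = 0" using assms[unfolded indep2_def, rule_format, of l "- k"] by simp
  then show False using \<open>b = k *\<^sub>R w\<close> indep2_nz[OF assms] by simp
qed

text \<open>Each cevian expresses the barycentric coordinates of \<open>P\<close> through one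
  parameter (\<open>s\<close>, \<open>r\<close> or \<open>q\<close>). Comparison gives
  \<open>s * w1 = r * v2\<close>, \<open>r * w2 = q * v3\<close> and \<open>q * w3 = s * v1\<close>,
  whose product is the claim.\<close>

lemma ceva_necessary:
  fixes A b c :: "'a::real_vector"
  assumes ind: "indep2 b c"
    and pos: "0 < v1" "0 < w1" "0 < v2" "0 < w2" "0 < v3" "0 < w3"
    and one: "v1 + w1 = 1" "v2 + w2 = 1" "v3 + w3 = 1"
    and P: "P \<in> closed_segment A (v1 *\<^sub>R (A + b) + w1 *\<^sub>R (A + c))"
      "P \<in> closed_segment (A + b) (v2 *\<^sub>R (A + c) + w2 *\<^sub>R A)"
      "P \<in> closed_segment (A + c) (v3 *\<^sub>R A + w3 *\<^sub>R (A + b))"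
  shows "w1 * w2 * w3 = v1 * v2 * v3"
proof -
  have v: "v1 = 1 - w1" "v2 = 1 - w2" "v3 = 1 - w3" using one by auto
  obtain s where "P = (1 - s) *\<^sub>R A + s *\<^sub>R (v1 *\<^sub>R (A + b) + w1 *\<^sub>R (A + c))"
    using P(1) by (auto simp: in_segment)
  then have s: "P - A = (s * v1) *\<^sub>R b + (s * w1) *\<^sub>R c" by (simp add: v algebra_simps)
  obtain r where "P = (1 - r) *\<^sub>R (A + b) + r *\<^sub>R (v2 *\<^sub>R (A + c) + w2 *\<^sub>R A)"
    using P(2) by (auto simp: in_segment)
  then have r: "P - A = (1 - r) *\<^sub>R b + (r * v2) *\<^sub>R c" by (simp add: v algebra_simps)
  obtain q where "P = (1 - q) *\<^sub>R (A + c) + q *\<^sub>R (v3 *\<^sub>R A + w3 *\<^sub>R (A + b))"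
    using P(3) by (auto simp: in_segment)
  then have q: "P - A = (q * w3) *\<^sub>R b + (1 - q) *\<^sub>R c" by (simp add: v algebra_simps)
  have 1: "s * v1 = 1 - r" "s * w1 = r * v2" using indep2_eq[OF ind] s r by metis+
  have 2: "s * v1 = q * w3" "s * w1 = 1 - q" using indep2_eq[OF ind] s q by metis+
  \<comment> \<open>Both sides equal \<open>1 - s\<close>, the coordinate of \<open>P\<close> at
    \<open>A\<close>.\<close>
  have 3: "r * w2 = q * v3" using 1 2 one by algebra
  have "s \<noteq> 0"
  proof
    assume "s = 0" then have "q = 1" "q * w3 = 0" using 2 by auto
    then show False using pos by simp
  qed
  then have "r \<noteq> 0" "q \<noteq> 0" using 1 2 pos by auto
  have "(w1 * w2 * w3) * (s * r * q) = (v1 * v2 * v3) * (s * r * q)"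
    using 1(2) 2(1) 3 by algebra
  then show ?thesis using \<open>s \<noteq> 0\<close> \<open>r \<noteq> 0\<close> \<open>q \<noteq> 0\<close> by simp
qed

section \<open>The cocycle identity for powers of points\<close>

locale concurrent_medians = open_convex_body +
  assumes concurrent: "hilbert_triangle K A B C \<Longrightarrow>
    \<exists>P. P \<in> hilbert_median K A B C \<and> P \<in> hilbert_median K B C A \<and> P \<in> hilbert_median K C A B"
begin

text \<open>Write \<open>B = A + b\<close>, \<open>C = A + c\<close>, and let the ratio of an edge
  \<open>XY\<close> be the power of \<open>X\<close> over the power of \<open>Y\<close>, both along
  \<open>XY\<close>. The identity says that the ratios of \<open>AB\<close>, \<open>BC\<close> and
  \<open>CA\<close> multiply to 1. It is Ceva's condition for the three Hilbert midpoints, squared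
  to remove the roots in their weights.\<close>

lemma power_along_cocycle:
  assumes ind: "indep2 b c" and A: "A \<in> K" and B: "A + b \<in> K" and C: "A + c \<in> K"
  shows "power_along (A + b) (c - b) * power_along (A + c) c * power_along A b
       = power_along (A + c) (c - b) * power_along A c * power_along (A + b) b"
proof -
  have nz: "b \<noteq> 0" "c \<noteq> 0" "c - b \<noteq> 0" using indep2_nz[OF ind] by auto
  define p1 where "p1 = sqrt (power_along (A + b) (c - b))"
  define q1 where "q1 = sqrt (power_along (A + c) (c - b))"
  define p2 where "p2 = sqrt (power_along (A + c) c)"
  define q2 where "q2 = sqrt (power_along A c)"
  define p3 where "p3 = sqrt (power_along A b)"
  define q3 where "q3 = sqrt (power_along (A + b) b)"
  note defs = p1_def q1_def p2_def q2_def p3_def q3_def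
  have pos: "p1 > 0" "q1 > 0" "p2 > 0" "q2 > 0" "p3 > 0" "q3 > 0"
    using power_along_pos nz A B C by (auto simp: defs)
  have m1: "hilbert_midpoint K (A + b) (A + c) = (q1 / (p1 + q1)) *\<^sub>R (A + b) + (p1 / (p1 + q1)) *\<^sub>R (A + c)"
    using hilbert_midpoint_eq[OF B C] nz by (simp add: defs)
  have m2: "hilbert_midpoint K (A + c) A = (q2 / (p2 + q2)) *\<^sub>R (A + c) + (p2 / (p2 + q2)) *\<^sub>R A"
    using hilbert_midpoint_eq[OF C A] nz by (simp add: defs power_along_minus)
  have m3: "hilbert_midpoint K A (A + b) = (q3 / (p3 + q3)) *\<^sub>R A + (p3 / (p3 + q3)) *\<^sub>R (A + b)"
    using hilbert_midpoint_eq[OF A B] nz by (simp add: defs)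
  obtain P where "P \<in> hilbert_median K A (A + b) (A + c)" "P \<in> hilbert_median K (A + b) (A + c) A"
    "P \<in> hilbert_median K (A + c) A (A + b)"
    using concurrent[of A "A + b" "A + c"] A B C indep2_not_collinear[OF ind]
    by (auto simp: hilbert_triangle_def)
  note P = this[unfolded hilbert_median_def m1 m2 m3]
  have "p1 / (p1 + q1) * (p2 / (p2 + q2)) * (p3 / (p3 + q3))
      = q1 / (p1 + q1) * (q2 / (p2 + q2)) * (q3 / (p3 + q3))"
    by (rule ceva_necessary[OF ind _ _ _ _ _ _ _ _ _ P])
      (use pos in \<open>auto simp: add_divide_distrib[symmetric] add.commute\<close>)
  moreover have "p1 + q1 \<noteq> 0" "p2 + q2 \<noteq> 0" "p3 + q3 \<noteq> 0" using pos by auto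
  moreover from this have "(p1 + q1) * (p2 + q2) * (p3 + q3) \<noteq> 0" by simp
  ultimately have "p1 * p2 * p3 = q1 * q2 * q3"
    by (simp only: times_divide_times_eq divide_cancel_right) simp
  then have "p1\<^sup>2 * p2\<^sup>2 * p3\<^sup>2 = q1\<^sup>2 * q2\<^sup>2 * q3\<^sup>2" by (metis power_mult_distrib)
  then show ?thesis
    using power_along_pos nz A B C by (simp add: defs less_imp_le)
qed

end

section \<open>The defect is a quadratic polynomial\<close>

locale pointed_concurrent_medians = concurrent_medians +
  fixes p :: 'a
  assumes base: "p \<in> K"
begin

section \<open>The gauge about the base point and the defect\<close>

text \<open>The gauge of \<open>K\<close> translated by \<open>-p\<close>. The origin is treated
  separately because \<open>exit_time p 0\<close> is unspecified.\<close>

definition minkowski :: "'a \<Rightarrow> real" where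
  "minkowski x = (if x = 0 then 0 else 1 / exit_time p x)"

text \<open>Homogeneity holds for every gauge; additivity is what concurrency of medians forces, see
  \<open>lin_add\<close>.\<close>

definition lin :: "'a \<Rightarrow> real" where
  "lin x = minkowski (- x) - minkowski x"

definition quad :: "'a \<Rightarrow> real" where
  "quad x = minkowski x * minkowski (- x)"

text \<open>For nonzero \<open>x\<close> with \<open>p + x\<close> in \<open>K\<close> this is the
  power of \<open>p + x\<close> along the line through \<open>p\<close>, divided by that of
  \<open>p\<close> (\<open>defect_eq_power_along\<close>). Its sign decides membership in
  \<open>K\<close> everywhere (\<open>defect_pos_iff\<close>).\<close>

definition defect :: "'a \<Rightarrow> real" where
  "defect x = 1 + lin x - quad x"

lemma minkowski_pos: "x \<noteq> 0 \<Longrightarrow> 0 < minkowski x"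
  by (simp add: minkowski_def exit_time_pos base)

lemma minkowski_nonneg: "0 \<le> minkowski x"
  using minkowski_pos[of x] by (cases "x = 0") (auto simp: minkowski_def)

lemma minkowski_scale: "0 \<le> c \<Longrightarrow> minkowski (c *\<^sub>R x) = c * minkowski x"
  using exit_time_scale[OF base, of x c] by (cases "c = 0") (auto simp: minkowski_def)

lemma minkowski_scale_neg: "c \<le> 0 \<Longrightarrow> minkowski (c *\<^sub>R x) = - c * minkowski (- x)"
  using minkowski_scale[of "- c" "- x"] by simp

lemma minkowski_less_1_iff: "p + x \<in> K \<longleftrightarrow> minkowski x < 1"
proof (cases "x = 0")
  case False
  then show ?thesis
    using exit_time_frontier[OF base, of x, THEN conjunct2, THEN conjunct2, rule_format, of 1]
      exit_time_pos[OF base, of x] by (simp add: minkowski_def)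
qed (simp add: base minkowski_def)

text \<open>A negative \<open>c\<close> swaps the two gauge values, which negates \<open>lin\<close>
  and fixes \<open>quad\<close>; so homogeneity holds for all real \<open>c\<close>.\<close>

lemma lin_scale: "lin (c *\<^sub>R x) = c * lin x"
  using minkowski_scale[of c x] minkowski_scale[of c "- x"] minkowski_scale_neg[of c x] minkowski_scale_neg[of c "- x"]
  by (cases "0 \<le> c") (auto simp: lin_def algebra_simps)

lemma quad_scale: "quad (c *\<^sub>R x) = c\<^sup>2 * quad x"
  using minkowski_scale[of c x] minkowski_scale[of c "- x"] minkowski_scale_neg[of c x] minkowski_scale_neg[of c "- x"]
  by (cases "0 \<le> c") (auto simp: quad_def power2_eq_square)

lemma quad_pos: "x \<noteq> 0 \<Longrightarrow> 0 < quad x"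
  by (simp add: quad_def minkowski_pos)

lemma defect_factor: "defect x = (1 + minkowski (- x)) * (1 - minkowski x)"
  by (simp add: defect_def lin_def quad_def algebra_simps)

lemma defect_pos_iff: "0 < defect x \<longleftrightarrow> p + x \<in> K"
  using minkowski_nonneg[of "- x"] by (simp add: defect_factor minkowski_less_1_iff zero_less_mult_iff)

lemma defect_eq_power_along:
  assumes "p + x \<in> K" "x \<noteq> 0"
  shows "power_along (p + x) x = defect x * power_along p x"
proof -
  have "exit_time (p + x) x = exit_time p x - 1" "exit_time (p + x) (- x) = exit_time p (- x) + 1"
    using exit_time_shift[OF base, of x 1] exit_time_shift_minus[OF base, of x 1] assms by auto
  moreover have "exit_time p x > 0" "exit_time p (- x) > 0"
    using exit_time_pos[OF base] assms by auto
  moreover have "(a - 1) * (b + 1) = (1 + 1 / b) * (1 - 1 / a) * (a * b)" if "0 < a" "0 < b" for a b :: real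
    using that by (simp add: field_simps)
  ultimately show ?thesis using assms(2)
    by (simp add: power_along_def defect_factor minkowski_def)
qed

section \<open>Restriction of the defect and its homogeneous parts to lines\<close>

text \<open>The cocycle identity is applied to the triangle \<open>p\<close>, \<open>p + x\<close>,
  \<open>p + x + r v\<close>. Along the two sides through \<open>p\<close> the powers turn into
  defects and powers of \<open>p\<close>, and the latter cancel. Hence the defect is a constant
  multiple of the power \<open>(a - r) * (b + r)\<close> along the line.\<close>

lemma defect_on_line:
  assumes ind: "indep2 x v" and x: "p + x \<in> K"
  shows "\<exists>A B C. \<forall>r. p + (x + r *\<^sub>R v) \<in> K \<longrightarrow> defect (x + r *\<^sub>R v) = A + B * r + C * r\<^sup>2"
proof -
  have nz: "x \<noteq> 0" "v \<noteq> 0" using indep2_nz[OF ind] by auto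
  define a where "a = exit_time (p + x) v"
  define b where "b = exit_time (p + x) (- v)"
  have ab: "power_along (p + x) v = a * b" "a * b > 0"
    using power_along_pos[OF x nz(2)] by (auto simp: power_along_def a_def b_def)
  then have nz': "a \<noteq> 0" "b \<noteq> 0" by auto
  \<comment> \<open>At \<open>r = 0\<close> the triangle degenerates and the equation is
    trivial.\<close>
  have eq: "defect (x + r *\<^sub>R v) * (a * b) = defect x * ((a - r) * (b + r))"
    if r: "p + (x + r *\<^sub>R v) \<in> K" for r
  proof (cases "r = 0")
    case False
    let ?y = "x + r *\<^sub>R v"
    have ind': "indep2 x ?y" using indep2_shear[OF ind False] .
    then have y: "?y \<noteq> 0" using indep2_nz by blast
    have rK: "p + x + r *\<^sub>R v \<in> K" using r by (simp add: add.assoc)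
    have pv: "power_along (p + ?y) v = (a - r) * (b + r)"
      using exit_time_shift[OF x nz(2) rK] exit_time_shift_minus[OF x nz(2) rK]
      by (simp add: power_along_def a_def b_def add.assoc)
    have "power_along (p + x) (r *\<^sub>R v) * (defect ?y * power_along p ?y) * power_along p x
      = power_along (p + ?y) (r *\<^sub>R v) * power_along p ?y * (defect x * power_along p x)"
      using power_along_cocycle[OF ind' base x r] defect_eq_power_along[OF x nz(1)]
        defect_eq_power_along[OF r y] by simp
    moreover have "power_along p ?y \<noteq> 0" "power_along p x \<noteq> 0"
      using power_along_pos[OF base] y nz by force+
    ultimately have "power_along (p + x) (r *\<^sub>R v) * defect ?y
      = power_along (p + ?y) (r *\<^sub>R v) * defect x" by simp
    then show ?thesis
      unfolding power_along_scale[OF x nz(2) False] power_along_scale[OF r nz(2) False] pv ab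
      using False by (simp add: field_simps)
  qed simp
  have "defect (x + r *\<^sub>R v) = defect x + (defect x * (a - b) / (a * b)) * r + (- defect x / (a * b)) * r\<^sup>2"
    if r: "p + (x + r *\<^sub>R v) \<in> K" for r
  proof -
    have "defect (x + r *\<^sub>R v) = defect x * ((a - r) * (b + r)) / (a * b)"
      using eq[OF r] ab(2) by (metis less_irrefl nonzero_eq_divide_eq)
    also have "\<dots> = defect x + (defect x * (a - b) / (a * b)) * r + (- defect x / (a * b)) * r\<^sup>2"
      using nz' by (simp add: field_simps power2_eq_square)
    finally show ?thesis .
  qed
  then show ?thesis by blast
qed

text \<open>A dilation by small \<open>c\<close> moves the segment into \<open>K\<close>, where the
  defect \<open>1 + c * lin - c\<^sup>2 * quad\<close> is quadratic in \<open>r\<close>. The bound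
  \<open>R\<close> lets one \<open>c\<close> serve the whole segment.\<close>

lemma lin_quad_on_segment:
  assumes ind: "indep2 x v" and "0 < R"
  shows "\<exists>A B C A' B' C'. \<forall>r. \<bar>r\<bar> \<le> R \<longrightarrow> lin (x + r *\<^sub>R v) = A + B * r + C * r\<^sup>2
    \<and> quad (x + r *\<^sub>R v) = A' + B' * r + C' * r\<^sup>2"
proof -
  obtain e where e: "e > 0" "ball p e \<subseteq> K" using open_K base open_contains_ball by blast
  \<comment> \<open>\<open>d\<close> strictly bounds the norm on the segment, so factors up to
    \<open>e / d\<close> shrink it into \<open>ball p e\<close>.\<close>
  define d where "d = norm x + R * norm v + 1"
  have d: "d > 0" using assms(2) by (simp add: d_def add_nonneg_pos)
  have inK: "p + c *\<^sub>R (x + r *\<^sub>R v) \<in> K" if "\<bar>r\<bar> \<le> R" "0 \<le> c" "c \<le> e / d" for c r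
  proof -
    have "norm (x + r *\<^sub>R v) \<le> norm x + \<bar>r\<bar> * norm v" using norm_triangle_ineq[of x "r *\<^sub>R v"] by simp
    also have "\<dots> < d" using that mult_right_mono[of "\<bar>r\<bar>" R "norm v"] by (simp add: d_def)
    finally have nd: "norm (x + r *\<^sub>R v) < d" .
    have "c * norm (x + r *\<^sub>R v) \<le> e / d * norm (x + r *\<^sub>R v)" using that by (intro mult_right_mono) auto
    also have "\<dots> < e / d * d" using nd e d by (intro mult_strict_left_mono) auto
    finally have "norm (c *\<^sub>R (x + r *\<^sub>R v)) < e" using that d by simp
    then show ?thesis using e(2) by (auto simp: dist_norm intro!: subsetD[OF e(2)])
  qed
  have line: "\<exists>A B C. \<forall>r. \<bar>r\<bar> \<le> R \<longrightarrow> 1 + c * lin (x + r *\<^sub>R v) - c\<^sup>2 * quad (x + r *\<^sub>R v) = A + B * r + C * r\<^sup>2"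
    if c: "0 < c" "c \<le> e / d" for c
  proof -
    have "p + c *\<^sub>R x \<in> K" using inK[of 0 c] c assms by simp
    then obtain A B C where *: "\<And>r. p + (c *\<^sub>R x + r *\<^sub>R c *\<^sub>R v) \<in> K \<Longrightarrow>
        defect (c *\<^sub>R x + r *\<^sub>R c *\<^sub>R v) = A + B * r + C * r\<^sup>2"
      using defect_on_line[OF indep2_scale[OF ind], of c] c by blast
    have "c *\<^sub>R x + r *\<^sub>R c *\<^sub>R v = c *\<^sub>R (x + r *\<^sub>R v)" for r by (simp add: algebra_simps)
    then have "1 + c * lin (x + r *\<^sub>R v) - c\<^sup>2 * quad (x + r *\<^sub>R v) = A + B * r + C * r\<^sup>2"
      if "\<bar>r\<bar> \<le> R" for r
      using *[of r] inK[OF that] c by (simp add: defect_def lin_scale quad_scale)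
    then show ?thesis by blast
  qed
  \<comment> \<open>Two different dilations separate the part of degree 1 from the part of degree 2.\<close>
  define c where "c = e / d"
  have c: "c > 0" using e d by (simp add: c_def)
  obtain A1 B1 C1 where 1: "\<And>r. \<bar>r\<bar> \<le> R \<Longrightarrow> 1 + c * lin (x + r *\<^sub>R v) - c\<^sup>2 * quad (x + r *\<^sub>R v) = A1 + B1 * r + C1 * r\<^sup>2"
    using line[of c] c by (auto simp: c_def)
  obtain A2 B2 C2 where 2: "\<And>r. \<bar>r\<bar> \<le> R \<Longrightarrow> 1 + c / 2 * lin (x + r *\<^sub>R v) - (c / 2)\<^sup>2 * quad (x + r *\<^sub>R v) = A2 + B2 * r + C2 * r\<^sup>2"
    using line[of "c / 2"] c by (auto simp: c_def)
  have "lin (x + r *\<^sub>R v) = (4 * A2 - A1 - 3) / c + ((4 * B2 - B1) / c) * r + ((4 * C2 - C1) / c) * r\<^sup>2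
    \<and> quad (x + r *\<^sub>R v) = (4 * A2 - 2 * A1 - 2) / c\<^sup>2 + ((4 * B2 - 2 * B1) / c\<^sup>2) * r + ((4 * C2 - 2 * C1) / c\<^sup>2) * r\<^sup>2"
    if r: "\<bar>r\<bar> \<le> R" for r
  proof -
    \<comment> \<open>Four times the identity for \<open>c / 2\<close>, minus the one for
      \<open>c\<close>, removes \<open>quad\<close>; minus twice the one for \<open>c\<close>, it
      removes \<open>lin\<close>.\<close>
    have "4 + 2 * c * lin (x + r *\<^sub>R v) - c\<^sup>2 * quad (x + r *\<^sub>R v) = 4 * (A2 + B2 * r + C2 * r\<^sup>2)"
      unfolding 2[OF r, symmetric] by (simp add: power2_eq_square algebra_simps)
    with 1[OF r] have "c * lin (x + r *\<^sub>R v) = (4 * A2 - A1 - 3) + (4 * B2 - B1) * r + (4 * C2 - C1) * r\<^sup>2"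
      "c\<^sup>2 * quad (x + r *\<^sub>R v) = (4 * A2 - 2 * A1 - 2) + (4 * B2 - 2 * B1) * r + (4 * C2 - 2 * C1) * r\<^sup>2"
      by (simp_all add: algebra_simps)
    then have "lin (x + r *\<^sub>R v) = ((4 * A2 - A1 - 3) + (4 * B2 - B1) * r + (4 * C2 - C1) * r\<^sup>2) / c"
      "quad (x + r *\<^sub>R v) = ((4 * A2 - 2 * A1 - 2) + (4 * B2 - 2 * B1) * r + (4 * C2 - 2 * C1) * r\<^sup>2) / c\<^sup>2"
      using c by (simp_all add: eq_divide_eq mult.commute)
    then show ?thesis by (simp add: add_divide_distrib)
  qed
  then show ?thesis by blast
qed

text \<open>A quadratic polynomial is determined by its values at 0, 1 and -1. The segment of radius
  \<open>max 1 \<bar>r\<bar>\<close> contains these and \<open>r\<close>, so the coefficients do not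
  depend on the segment.\<close>

lemma lin_quad_on_line:
  assumes ind: "indep2 x v"
  shows "lin (x + r *\<^sub>R v) = lin x + (lin (x + v) - lin (x - v)) / 2 * r + ((lin (x + v) + lin (x - v)) / 2 - lin x) * r\<^sup>2"
    and "quad (x + r *\<^sub>R v) = quad x + (quad (x + v) - quad (x - v)) / 2 * r + ((quad (x + v) + quad (x - v)) / 2 - quad x) * r\<^sup>2"
proof -
  have R: "0 < max 1 \<bar>r\<bar>" by simp
  obtain A B C A' B' C' where *: "\<And>s. \<bar>s\<bar> \<le> max 1 \<bar>r\<bar> \<Longrightarrow> lin (x + s *\<^sub>R v) = A + B * s + C * s\<^sup>2
    \<and> quad (x + s *\<^sub>R v) = A' + B' * s + C' * s\<^sup>2"
    using lin_quad_on_segment[OF ind, of "max 1 \<bar>r\<bar>", OF R] by blast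
  have l: "lin x = A" "lin (x + v) = A + B + C" "lin (x - v) = A - B + C"
    and q: "quad x = A'" "quad (x + v) = A' + B' + C'" "quad (x - v) = A' - B' + C'"
    using *[of 0] *[of 1] *[of "-1"] by auto
  have r: "lin (x + r *\<^sub>R v) = A + B * r + C * r\<^sup>2" "quad (x + r *\<^sub>R v) = A' + B' * r + C' * r\<^sup>2"
    using *[of r] by auto
  show "lin (x + r *\<^sub>R v) = lin x + (lin (x + v) - lin (x - v)) / 2 * r + ((lin (x + v) + lin (x - v)) / 2 - lin x) * r\<^sup>2"
    unfolding l r by (simp add: field_simps)
  show "quad (x + r *\<^sub>R v) = quad x + (quad (x + v) - quad (x - v)) / 2 * r + ((quad (x + v) + quad (x - v)) / 2 - quad x) * r\<^sup>2"
    unfolding q r by (simp add: field_simps)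
qed

text \<open>Homogeneity turns the line through \<open>x\<close> in direction \<open>v\<close> into the line through \<open>v\<close> in
  direction \<open>x\<close>, with parameter \<open>1 / r\<close>; comparing the two expansions, which are both quadratic,
  kills or identifies the extreme coefficients.\<close>

lemma line_inversion: "r \<noteq> 0 \<Longrightarrow> x + r *\<^sub>R v = r *\<^sub>R (v + (1 / r) *\<^sub>R (x::'a))"
  by (simp add: algebra_simps)

section \<open>Linearity of \<open>lin\<close> and the quadratic identity for
  \<open>quad\<close>\<close>

lemma lin_add_indep2:
  assumes ind: "indep2 x v"
  shows "lin (x + v) = lin x + lin v"
proof -
  define B C where "B = (lin (x + v) - lin (x - v)) / 2" "C = (lin (x + v) + lin (x - v)) / 2 - lin x"
  define B' C' where "B' = (lin (v + x) - lin (v - x)) / 2" "C' = (lin (v + x) + lin (v - x)) / 2 - lin v"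
  have 1: "lin (x + r *\<^sub>R v) = lin x + B * r + C * r\<^sup>2" for r
    using lin_quad_on_line(1)[OF ind, of r] by (simp add: B_C_def)
  have "lin (x + r *\<^sub>R v) = r * (lin v + B' * (1 / r) + C' * (1 / r)\<^sup>2)" if "r \<noteq> 0" for r
    unfolding line_inversion[OF that] lin_scale
    using lin_quad_on_line(1)[OF indep2_swap[OF ind], of "1 / r"] by (simp add: B'_C'_def)
  then have "lin x + B * r + C * r\<^sup>2 = r * (lin v + B' * (1 / r) + C' * (1 / r)\<^sup>2)" if "r \<noteq> 0" for r
    using 1 that by metis
  \<comment> \<open>Both sides are combinations of \<open>1 / r\<close>, \<open>1\<close>,
    \<open>r\<close> and \<open>r\<^sup>2\<close>; four values of \<open>r\<close> identify the
    coefficients.\<close>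
  from this[of 1] this[of "-1"] this[of 2] this[of "-2"] have "B = lin v" "C = 0"
    by (simp_all add: power2_eq_square)
  then show ?thesis using 1[of 1] by simp
qed

lemma quad_line_indep2:
  assumes ind: "indep2 x v"
  shows "quad (x + r *\<^sub>R v) = quad x + (quad (x + v) - quad (x - v)) / 2 * r + quad v * r\<^sup>2"
proof -
  define B C where "B = (quad (x + v) - quad (x - v)) / 2" "C = (quad (x + v) + quad (x - v)) / 2 - quad x"
  define B' C' where "B' = (quad (v + x) - quad (v - x)) / 2" "C' = (quad (v + x) + quad (v - x)) / 2 - quad v"
  have 1: "quad (x + r *\<^sub>R v) = quad x + B * r + C * r\<^sup>2" for r
    using lin_quad_on_line(2)[OF ind, of r] by (simp add: B_C_def)
  have "quad (x + r *\<^sub>R v) = r\<^sup>2 * (quad v + B' * (1 / r) + C' * (1 / r)\<^sup>2)" if "r \<noteq> 0" for r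
    unfolding line_inversion[OF that] quad_scale
    using lin_quad_on_line(2)[OF indep2_swap[OF ind], of "1 / r"] by (simp add: B'_C'_def)
  then have "quad x + B * r + C * r\<^sup>2 = r\<^sup>2 * (quad v + B' * (1 / r) + C' * (1 / r)\<^sup>2)" if "r \<noteq> 0" for r
    using 1 that by metis
  from this[of 1] this[of "-1"] this[of 2] this[of "-2"] have "C = quad v"
    by (simp add: power2_eq_square)
  then show ?thesis using 1[of r] by (simp add: B_C_def)
qed

lemma lin_add: "lin (x + v) = lin x + lin v"
proof (cases "indep2 x v")
  case False
  then show ?thesis
  proof (cases rule: not_indep2E)
    case (2 c)
    then have "x + v = (1 + c) *\<^sub>R x" by (simp add: algebra_simps)
    then have "lin (x + v) = (1 + c) * lin x" using lin_scale by metis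
    then show ?thesis using 2 lin_scale[of c x] by (simp add: algebra_simps)
  qed (simp add: lin_def minkowski_def)
qed (rule lin_add_indep2)

lemma linear_lin: "linear lin"
  by (rule linearI) (simp_all add: lin_add lin_scale)

text \<open>For a dependent pair all vectors involved are multiples of a single one, and homogeneity
  gives the identity.\<close>

lemma quad_line:
  "quad (x + r *\<^sub>R v) = quad x + (quad (x + v) - quad (x - v)) / 2 * r + quad v * r\<^sup>2"
proof (cases "indep2 x v")
  case False
  then show ?thesis
  proof (cases rule: not_indep2E)
    case 1
    have "quad (- v) = quad v" "quad 0 = 0" using quad_scale[of "-1" v] quad_scale[of 0 v] by auto
    then show ?thesis using 1 by (simp add: quad_scale)
  next
    case (2 c)
    have *: "x + s *\<^sub>R v = (1 + s * c) *\<^sub>R x" for s using 2 by (simp add: algebra_simps)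
    have e1: "quad (x + v) = (1 + c)\<^sup>2 * quad x" using *[of 1] quad_scale[of "1 + c" x] by simp
    have e2: "quad (x - v) = (1 - c)\<^sup>2 * quad x" using *[of "-1"] quad_scale[of "1 - c" x] by simp
    have e3: "quad v = c\<^sup>2 * quad x" using 2 quad_scale by simp
    have e4: "quad (x + r *\<^sub>R v) = (1 + r * c)\<^sup>2 * quad x" unfolding * quad_scale ..
    show ?thesis unfolding e1 e2 e3 e4 by (simp add: power2_eq_square field_simps)
  qed
qed (rule quad_line_indep2)

end
section \<open>Diagonalisation\<close>

text \<open>The spectral theorem by induction on dimension; the subspace \<open>S\<close> is kept
  general so that the induction can pass to an orthogonal complement inside it.\<close>

lemma symmetric_bilinear_diagonal:
  fixes B :: "'a::euclidean_space \<Rightarrow> 'a \<Rightarrow> real"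
  assumes B: "bilinear B" and sym: "\<And>x y. B x y = B y x" and "subspace S"
  shows "\<exists>U\<subseteq>S. pairwise orthogonal U \<and> (\<forall>u\<in>U. norm u = 1) \<and> span U = S
    \<and> pairwise (\<lambda>u v. B u v = 0) U"
  using assms(3)
proof (induction "dim S" arbitrary: S rule: less_induct)
  case less
  show ?case
  proof (cases "S = {0}")
    case True
    then show ?thesis by (intro exI[of _ "{}"]) auto
  next
    case False
    then obtain x where x: "x \<in> S" "x \<noteq> 0" using less.prems subspace_0 by blast
    have "x /\<^sub>R norm x \<in> sphere 0 1 \<inter> S" using x less.prems by (simp add: subspace_scale)
    moreover have "compact (sphere 0 1 \<inter> S)"
      using closed_subspace[OF less.prems] by (intro compact_Int_closed) auto
    moreover have "continuous_on (sphere 0 1 \<inter> S) (\<lambda>x. B x x)"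
      using bilinear_continuous_on_compose[OF continuous_on_id continuous_on_id B] .
    ultimately obtain u where u: "u \<in> S" "norm u = 1"
      and max: "\<And>y. y \<in> S \<Longrightarrow> norm y = 1 \<Longrightarrow> B y y \<le> B u u"
      using continuous_attains_sup[of "sphere 0 1 \<inter> S" "\<lambda>x. B x x"]
      by (metis (no_types, lifting) Int_iff dist_0_norm empty_iff mem_sphere)
    have uu: "u \<bullet> u = 1" using u by (simp add: dot_square_norm)
    have maxs: "B y y \<le> B u u * (y \<bullet> y)" if "y \<in> S" for y
    proof (cases "y = 0")
      case True then show ?thesis by (simp add: bilinear_lzero[OF B])
    next
      case False
      have "B (y /\<^sub>R norm y) (y /\<^sub>R norm y) \<le> B u u"
        using that less.prems False by (intro max) (auto simp: subspace_scale)
      then show ?thesis using False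
        by (simp add: bilinear_lmul[OF B] bilinear_rmul[OF B] dot_square_norm power2_eq_square field_simps)
    qed
    have orth: "B u v = 0" if v: "v \<in> S" "u \<bullet> v = 0" for v
    proof (rule ccontr)
      assume ne: "B u v \<noteq> 0"
      \<comment> \<open>First-order variation of the maximiser: moving from \<open>u\<close> to
        \<open>u + t v\<close> changes the comparison by \<open>2 * t * B u v\<close> plus a term of
        order \<open>t\<^sup>2\<close>. As \<open>k\<close> exceeds the size of that quadratic
        coefficient, \<open>t = B u v / k\<close> lets the linear term win.\<close>
      define k where "k = \<bar>B v v - B u u * (v \<bullet> v)\<bar> + 1"
      have k: "k > 0" by (simp add: k_def)
      define t where "t = B u v / k"
      have "B (u + t *\<^sub>R v) (u + t *\<^sub>R v) \<le> B u u * ((u + t *\<^sub>R v) \<bullet> (u + t *\<^sub>R v))"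
        using v u less.prems by (intro maxs) (auto simp: subspace_add subspace_scale)
      then have "2 * t * B u v + t\<^sup>2 * (B v v - B u u * (v \<bullet> v)) \<le> 0"
        using v uu sym[of v u]
        by (simp add: bilinear_ladd[OF B] bilinear_radd[OF B] bilinear_lmul[OF B] bilinear_rmul[OF B]
            inner_add_left inner_add_right inner_commute[of v u] power2_eq_square algebra_simps)
      moreover have "t\<^sup>2 * (- k) \<le> t\<^sup>2 * (B v v - B u u * (v \<bullet> v))"
        by (intro mult_left_mono) (auto simp: k_def)
      ultimately have "2 * t * B u v \<le> t\<^sup>2 * k" by simp
      then have "2 * (B u v)\<^sup>2 \<le> (B u v)\<^sup>2"
        using k by (simp add: t_def power2_eq_square field_simps)
      then show False using ne by simp
    qed
    \<comment> \<open>\<open>u\<close> maximises \<open>B y y / |y|\<^sup>2\<close> on \<open>S\<close>, so the problem splits off \<open>u\<close>.\<close>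
    define T where "T = S \<inter> {v. u \<bullet> v = 0}"
    have T: "subspace T" unfolding T_def by (intro subspace_inter less.prems subspace_hyperplane)
    have "u \<notin> T" using uu by (simp add: T_def)
    moreover have "T \<subseteq> S" by (simp add: T_def)
    ultimately have "T \<subset> S" using u(1) by blast
    then have "dim T < dim S" using T less.prems by (metis dim_psubset span_eq_iff)
    from less.hyps[OF this T] obtain U where U: "U \<subseteq> T" "pairwise orthogonal U" "\<forall>u\<in>U. norm u = 1"
      "span U = T" "pairwise (\<lambda>u v. B u v = 0) U" by blast
    have "span (insert u U) = S"
    proof
      show "span (insert u U) \<subseteq> S" using U u less.prems by (intro span_minimal) (auto simp: T_def)
      show "S \<subseteq> span (insert u U)"
      proof
        fix y assume y: "y \<in> S"
        have "y - (u \<bullet> y) *\<^sub>R u \<in> T"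
          using y u uu less.prems by (auto simp: T_def subspace_diff subspace_scale inner_diff_right)
        then show "y \<in> span (insert u U)" using U(4) by (auto simp: span_insert)
      qed
    qed
    moreover have "u \<bullet> v = 0 \<and> v \<bullet> u = 0 \<and> B u v = 0 \<and> B v u = 0" if "v \<in> U" for v
      using U(1) that orth sym[of v u] by (auto simp: T_def inner_commute)
    then have "pairwise orthogonal (insert u U)" "pairwise (\<lambda>u v. B u v = 0) (insert u U)"
      using U(2,5) by (auto simp: pairwise_insert orthogonal_def)
    ultimately show ?thesis using U u by (intro exI[of _ "insert u U"]) (auto simp: T_def)
  qed
qed

section \<open>Polarisation and completing the square\<close>

text \<open>At \<open>r = 1\<close> the hypothesis is the parallelogram law, which yields additivity
  of the polarisation; comparing \<open>r\<close> with \<open>-r\<close> yields its homogeneity over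
  the reals.\<close>

lemma quadratic_on_lines_bilinear:
  fixes Q :: "'a::real_vector \<Rightarrow> real"
  assumes line: "\<And>x v r. Q (x + r *\<^sub>R v) = Q x + (Q (x + v) - Q (x - v)) / 2 * r + Q v * r\<^sup>2"
  defines "B \<equiv> \<lambda>x y. (Q (x + y) - Q (x - y)) / 4"
  shows "bilinear B" "B x y = B y x" "B x x = Q x"
proof -
  have par: "Q (x + y) + Q (x - y) = 2 * Q x + 2 * Q y" for x y
    using line[of x 1 y] by (simp add: field_simps)
  have Q0: "Q 0 = 0" using par[of 0 0] by simp
  have even: "Q (- x) = Q x" for x using par[of 0 x] Q0 by simp
  have flip: "Q (x - y) = Q (y - x)" for x y using even[of "x - y"] by simp
  show sym: "B x y = B y x" for x y by (simp add: B_def add.commute flip[of x y])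
  show "B x x = Q x" using par[of x x] Q0 by (simp add: B_def)
  have scale: "B x (r *\<^sub>R y) = r * B x y" for x y r
    using line[of x r y] line[of x "- r" y] by (simp add: B_def)
  \<comment> \<open>In the alternating sum of the four parallelogram laws the unwanted terms cancel
    because \<open>Q\<close> is even.\<close>
  have "Q (x + z + y) - Q (x + z - y) = (Q (x + y) - Q (x - y)) + (Q (z + y) - Q (z - y))" for x y z
    using par[of "x + y" z] par[of "x - y" z] par[of "z + y" x] par[of "z - y" x]
      flip[of "x + y" z] flip[of "x - y" z]
    by (simp add: algebra_simps)
  then have add: "B (x + z) y = B x y + B z y" for x y z
    by (simp add: B_def add_divide_distrib)
  have "linear (\<lambda>y. B x y)" for x
    by (rule linearI) (simp_all add: sym[of x] add scale flip: sym[of _ x])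
  moreover have "linear (\<lambda>x. B x y)" for y
    using calculation[of y] sym by simp
  ultimately show "bilinear B" by (simp add: bilinear_def)
qed

text \<open>In an orthonormal basis diagonalising \<open>Q\<close>, the inequality splits into
  one-variable quadratics, and completing each square reveals centre and semi-axes.\<close>

lemma open_ellipsoid_quadratic:
  fixes Q L :: "real ^ 'n \<Rightarrow> real" and c :: "real ^ 'n"
  assumes line: "\<And>x v r. Q (x + r *\<^sub>R v) = Q x + (Q (x + v) - Q (x - v)) / 2 * r + Q v * r\<^sup>2"
    and pos: "\<And>x. x \<noteq> 0 \<Longrightarrow> 0 < Q x" and L: "linear L"
    and K: "\<And>x. c + x \<in> K \<longleftrightarrow> 0 < 1 + L x - Q x"
  shows "open_ellipsoid K"
proof -
  define B where "B = (\<lambda>x y. (Q (x + y) - Q (x - y)) / 4)"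
  have B: "bilinear B" "\<And>x y. B x y = B y x" "\<And>x. B x x = Q x"
    unfolding B_def using quadratic_on_lines_bilinear[of Q, OF line] by blast+
  obtain U where U: "pairwise orthogonal U" "\<And>u. u \<in> U \<Longrightarrow> norm u = 1" "span U = UNIV"
    "pairwise (\<lambda>u v. B u v = 0) U"
    using symmetric_bilinear_diagonal[OF B(1,2) subspace_UNIV] by blast
  have "0 \<notin> U" using U(2) by force
  then have ind: "independent U" using pairwise_orthogonal_independent U(1) by blast
  have fin: "finite U" using ind by (rule independent_imp_finite)
  have "card U = CARD('n)" using ind U(3) by (metis dim_UNIV dim_eq_card_independent dim_span DIM_cart DIM_real mult.right_neutral)
  then obtain e where e: "bij_betw e (UNIV :: 'n set) U"
    using finite_same_card_bij[OF finite fin] by auto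
  have eU: "e i \<in> U" for i using e by (auto simp: bij_betw_def)
  have e_eq: "e i = e j \<longleftrightarrow> i = j" for i j using e by (auto simp: bij_betw_def inj_def)
  have ee: "e i \<bullet> e j = (if i = j then 1 else 0)" for i j
    using U(1,2) eU e_eq by (auto simp: pairwise_def orthogonal_def dot_square_norm)
  have Be: "B (e i) (e j) = (if i = j then Q (e i) else 0)" for i j
    using U(4) eU e_eq B(3) by (auto simp: pairwise_def)
  \<comment> \<open>\<open>g\<close> is the linear isometry sending the standard basis to
    \<open>e\<close>.\<close>
  define g where "g y = (\<Sum>i\<in>UNIV. y $ i *\<^sub>R e i)" for y :: "real ^ 'n"
  have gdiff: "g x - g y = g (x - y)" for x y
    by (simp add: g_def sum_subtractf algebra_simps)
  have gnorm: "norm (g y) = norm y" for y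
  proof -
    have "g y \<bullet> g y = (\<Sum>i\<in>UNIV. y $ i * y $ i)"
      by (simp add: g_def inner_sum_left inner_sum_right ee if_distrib cong: if_cong)
    then show ?thesis by (simp add: norm_eq_sqrt_inner inner_vec_def)
  qed
  have gsurj: "\<exists>y. z = g y" for z
  proof -
    have "z \<in> span (range e)" using U(3) e by (simp add: bij_betw_def)
    then show ?thesis
    proof (induction rule: span_induct_alt)
      case base
      show ?case by (rule exI[of _ 0]) (simp add: g_def)
    next
      case (step k x z)
      then obtain i y where "x = e i" "z = g y" by auto
      moreover have "g (k *\<^sub>R axis i 1) = k *\<^sub>R e i"
        by (simp add: g_def axis_def if_distrib if_distribR cong: if_cong)
      moreover have "g (a + b) = g a + g b" for a b by (simp add: g_def sum.distrib algebra_simps)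
      ultimately show ?case by metis
    qed
  qed
  define l where "l i = L (e i)" for i
  define q where "q i = Q (e i)" for i
  have q: "q i > 0" for i using pos[of "e i"] eU[of i] \<open>0 \<notin> U\<close> unfolding q_def by metis
  have Qg: "Q (g y) = (\<Sum>i\<in>UNIV. q i * (y $ i)\<^sup>2)" for y
  proof -
    have "Q (g y) = (\<Sum>i\<in>UNIV. \<Sum>j\<in>UNIV. B (y $ i *\<^sub>R e i) (y $ j *\<^sub>R e j))"
      unfolding B(3)[symmetric] g_def
      by (subst bilinear_sum[OF B(1)]) (simp_all add: sum.cartesian_product)
    also have "\<dots> = (\<Sum>i\<in>UNIV. q i * (y $ i)\<^sup>2)"
      by (simp add: bilinear_lmul[OF B(1)] bilinear_rmul[OF B(1)] Be q_def power2_eq_square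
          if_distrib mult_ac cong: if_cong)
    finally show ?thesis .
  qed
  have Lg: "L (g y) = (\<Sum>i\<in>UNIV. l i * y $ i)" for y
    by (simp add: g_def linear_sum[OF L] linear_scale[OF L] l_def mult.commute)
  \<comment> \<open>\<open>D\<close> is the constant left after completing the squares,
    \<open>m\<close> the centre in the coordinates of \<open>e\<close>, and \<open>a\<close> the
    semi-axes, so that \<open>D / (a $ i)\<^sup>2 = q i\<close>.\<close>
  define D where "D = 1 + (\<Sum>i\<in>UNIV. (l i)\<^sup>2 / (4 * q i))"
  have D: "D > 0" using q by (auto simp: D_def intro!: add_pos_nonneg sum_nonneg divide_nonneg_pos)
  define m where "m = (\<chi> i. l i / (2 * q i))"
  define a where "a = (\<chi> i. sqrt (D / q i))"
  define f where "f x = c + g (x + m)" for x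
  have fg: "1 + L (g (x + m)) - Q (g (x + m)) = D * (1 - (\<Sum>i\<in>UNIV. (x $ i)\<^sup>2 / (a $ i)\<^sup>2))" for x
  proof -
    have "l i * (x + m) $ i - q i * ((x + m) $ i)\<^sup>2 = (l i)\<^sup>2 / (4 * q i) - D * ((x $ i)\<^sup>2 / (a $ i)\<^sup>2)" for i
      using q[of i] D by (simp add: m_def a_def power2_eq_square field_simps)
    then have "L (g (x + m)) - Q (g (x + m))
      = (\<Sum>i\<in>UNIV. (l i)\<^sup>2 / (4 * q i)) - D * (\<Sum>i\<in>UNIV. (x $ i)\<^sup>2 / (a $ i)\<^sup>2)"
      by (simp only: Lg Qg sum_distrib_left sum_subtractf[symmetric])
    then show ?thesis by (simp add: D_def right_diff_distrib)
  qed
  have fK: "f x \<in> K \<longleftrightarrow> (\<Sum>i\<in>UNIV. (x $ i)\<^sup>2 / (a $ i)\<^sup>2) < 1" for x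
    using D unfolding f_def K fg by (simp add: zero_less_mult_iff)
  have "\<exists>x. z = f x" for z
    using gsurj[of "z - c"] by (metis add.commute diff_add_cancel f_def)
  then have "K = f ` {x. f x \<in> K}" by (simp add: image_Collect set_eq_iff) metis
  then have "K = f ` {x. (\<Sum>i\<in>UNIV. (x $ i)\<^sup>2 / (a $ i)\<^sup>2) < 1}" unfolding fK .
  moreover have "dist (f x) (f y) = dist x y" for x y
    by (simp add: f_def dist_norm gdiff gnorm)
  moreover have "a $ i \<noteq> 0" for i using q[of i] D by (simp add: a_def)
  ultimately show ?thesis unfolding open_ellipsoid_def by blast
qed

theorem theorem1:
  fixes K :: "(real ^ 'n) set"
  assumes "CARD('n) \<ge> 2"
    and "K \<noteq> {}" and "bounded K" and "open K" and "convex K"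
    and "\<And>A B C. hilbert_triangle K A B C \<Longrightarrow>
           \<exists>P. P \<in> hilbert_median K A B C \<and> P \<in> hilbert_median K B C A \<and> P \<in> hilbert_median K C A B"
  shows "open_ellipsoid K"
proof -
  obtain p where "p \<in> K" using assms(2) by blast
  \<comment> \<open>Any point of \<open>K\<close> can serve as the base point.\<close>
  then interpret pointed_concurrent_medians K p
    by unfold_locales (use assms in auto)
  show ?thesis
  proof (rule open_ellipsoid_quadratic)
    show "linear lin" by (rule linear_lin)
    show "quad (x + r *\<^sub>R v) = quad x + (quad (x + v) - quad (x - v)) / 2 * r + quad v * r\<^sup>2" for x v r
      by (rule quad_line)
    show "x \<noteq> 0 \<Longrightarrow> 0 < quad x" for x by (rule quad_pos)
    show "p + x \<in> K \<longleftrightarrow> 0 < 1 + lin x - quad x" for x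
      using defect_pos_iff[of x] by (simp add: defect_def)
  qed
qed

end
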